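(* For every integer $n\geq 5$, $$\mathrm{MOP}(n,2)\ \geq\ \left\lceil\frac{4n+10}{9}\right\rceil ,$$ with equality when $n\equiv 2\ (\mathrm{mod}\ 18)$, and $\mathrm{MOP}(n,2)\leq\left\lceil(4n+10)/9\right\rceil+43$ for every $n\geq 20$. In particular $\mathrm{MOP}(n,2)=4n/9+O(1)$.
   Context: For a graph $G$ and $B\subseteq V(G)$ the spread is $\mathrm{sp}(B)=\max_{u\in B}\deg_G(u)-\min_{v\in B}\deg_G(v)$, and $\mathrm{sp}(G,k)$ is the largest cardinality of a set $B\subseteq V(G)$ with $\mathrm{sp}(B)\leq k$. A graph is maximal outerplanar (a MOP) if it is outerplanar and the addition of any edge destroys outerplanarity; equivalently, a MOP of order $n\geq 3$ is a triangulation of a convex $n$-gon (the graph formed by the sides of the $n$-gon and $n-3$ pairwise non-crossing diagonals). $\mathrm{MOP}(n,k)=\min\{\mathrm{sp}(G,k):G\text{ is a MOP of order }n\}$. *)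

theory Defs
  imports Complex_Main "HOL-Library.Landau_Symbols"
begin

section \<open>Finite simple graphs and spread\<close>

definition simple_graph :: "'a set \<Rightarrow> 'a set set \<Rightarrow> bool" where
  "simple_graph V E \<longleftrightarrow> finite V \<and> (\<forall>e\<in>E. e \<subseteq> V \<and> card e = 2)"

definition deg :: "'a set set \<Rightarrow> 'a \<Rightarrow> nat" where
  "deg E v = card {e \<in> E. v \<in> e}"

definition spread :: "'a set set \<Rightarrow> 'a set \<Rightarrow> nat" where
  "spread E B = Max (deg E ` B) - Min (deg E ` B)"

text \<open>The spread is meaningful for nonempty sets only, hence the condition on \<open>B\<close>;
  singletons have spread \<open>0\<close>.\<close>

definition spread_number :: "'a set \<Rightarrow> 'a set set \<Rightarrow> nat \<Rightarrow> nat" where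
  "spread_number V E k = Max {card B | B. B \<subseteq> V \<and> B \<noteq> {} \<and> spread E B \<le> k}"

section \<open>Maximal outerplanar graphs\<close>

text \<open>The corners of a convex \<open>n\<close>-gon are numbered \<open>0, \<dots>, n - 1\<close> in cyclic order. Two chords
  between corners cross in an interior point iff their endpoints are distinct and interleave.
  The relation below is not symmetric, but it is always applied to all ordered pairs.\<close>

definition chords_cross :: "nat set \<Rightarrow> nat set \<Rightarrow> bool" where
  "chords_cross e e' \<longleftrightarrow> (\<exists>i j k l. e = {i, j} \<and> e' = {k, l} \<and> i < k \<and> k < j \<and> j < l)"

definition noncrossing :: "nat set set \<Rightarrow> bool" where
  "noncrossing F \<longleftrightarrow> (\<forall>e\<in>F. \<forall>e'\<in>F. \<not> chords_cross e e')"

text \<open>A graph is outerplanar if it can be drawn in the plane without crossings and with all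
  vertices on the outer face. Such a drawing can be taken with the vertices as the corners of a
  convex polygon and the edges as straight, pairwise non-crossing chords.\<close>

definition outerplanar :: "'a set \<Rightarrow> 'a set set \<Rightarrow> bool" where
  "outerplanar V E \<longleftrightarrow> simple_graph V E \<and>
     (\<exists>f. bij_betw f V {..<card V} \<and> noncrossing ((`) f ` E))"

definition maximal_outerplanar :: "'a set \<Rightarrow> 'a set set \<Rightarrow> bool" where
  "maximal_outerplanar V E \<longleftrightarrow> outerplanar V E \<and>
     (\<forall>u\<in>V. \<forall>v\<in>V. u \<noteq> v \<and> {u, v} \<notin> E \<longrightarrow> \<not> outerplanar V (insert {u, v} E))"

text \<open>Every finite graph is isomorphic to one whose vertices are natural numbers, so it is no
  restriction to let the minimum range over those.\<close>

definition MOP :: "nat \<Rightarrow> nat \<Rightarrow> nat" where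
  "MOP n k = Min {spread_number V E k | (V :: nat set) E. maximal_outerplanar V E \<and> card V = n}"

text \<open>For \<open>n \<ge> 1\<close> the minimum defining \<open>MOP\<close> ranges over a finite nonempty set.\<close>

lemma maximal_outerplanar_exists: "\<exists>E. maximal_outerplanar {..<n :: nat} E"
proof -
  let ?S = "{E. outerplanar {..<n} E}"
  have "?S \<subseteq> Pow (Pow {..<n})" by (auto simp: outerplanar_def simple_graph_def)
  then have "finite ?S" by (rule finite_subset) auto
  moreover have "{} \<in> ?S"
    by (auto simp: outerplanar_def simple_graph_def noncrossing_def intro!: exI[of _ id])
  ultimately have "\<exists>E\<in>?S. \<forall>E'\<in>?S. E \<subseteq> E' \<longrightarrow> E = E'"
    by (intro finite_has_maximal) auto
  then obtain E where E: "outerplanar {..<n} E"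
      and max: "\<And>E'. outerplanar {..<n} E' \<Longrightarrow> E \<subseteq> E' \<Longrightarrow> E = E'"
    by auto
  have "\<not> outerplanar {..<n} (insert e E)" if "e \<notin> E" for e
    using max[of "insert e E"] that by auto
  then have "maximal_outerplanar {..<n} E" using E by (simp add: maximal_outerplanar_def)
  then show ?thesis ..
qed

lemma spread_number_bounds:
  assumes "finite V" "V \<noteq> {}"
  shows "1 \<le> spread_number V E k" "spread_number V E k \<le> card V"
proof -
  let ?S = "{card B | B. B \<subseteq> V \<and> B \<noteq> {} \<and> spread E B \<le> k}"
  have "?S \<subseteq> {..card V}" using assms(1) by (auto intro: card_mono)
  then have fin: "finite ?S" by (rule finite_subset) auto
  obtain v where "v \<in> V" using assms(2) by auto
  then have "card {v} \<in> ?S" by (intro CollectI exI[of _ "{v}"]) (auto simp: spread_def)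
  then have "1 \<in> ?S" by simp
  then show "1 \<le> spread_number V E k"
    unfolding spread_number_def using fin by (rule Max_ge[rotated])
  have "Max ?S \<in> ?S" using fin \<open>1 \<in> ?S\<close> by (intro Max_in) auto
  then show "spread_number V E k \<le> card V"
    unfolding spread_number_def using \<open>?S \<subseteq> {..card V}\<close> by auto
qed

lemma MOP_attained:
  assumes "1 \<le> n"
  shows "\<exists>(V :: nat set) E. maximal_outerplanar V E \<and> card V = n \<and> MOP n k = spread_number V E k"
    and "maximal_outerplanar (W :: nat set) F \<Longrightarrow> card W = n \<Longrightarrow> MOP n k \<le> spread_number W F k"
proof -
  let ?S = "{spread_number V E k | (V :: nat set) E. maximal_outerplanar V E \<and> card V = n}"
  have "spread_number V E k \<le> n" if "maximal_outerplanar V E" "card V = n"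
    for V :: "nat set" and E
  proof -
    have "0 < card V" using that(2) assms by simp
    then have "finite V" "V \<noteq> {}" by (auto simp: card_gt_0_iff)
    then show ?thesis using spread_number_bounds(2)[of V E k] that(2) by simp
  qed
  then have "?S \<subseteq> {..n}" by auto
  then have fin: "finite ?S" by (rule finite_subset) auto
  obtain E where "maximal_outerplanar {..<n} E" using maximal_outerplanar_exists by blast
  then have "spread_number {..<n} E k \<in> ?S" by (intro CollectI exI[of _ "{..<n}"] exI[of _ E]) simp
  then have "?S \<noteq> {}" by blast
  then have "MOP n k \<in> ?S" unfolding MOP_def using fin by (intro Min_in)
  then show "\<exists>(V :: nat set) E. maximal_outerplanar V E \<and> card V = n \<and> MOP n k = spread_number V E k"
    by blast
  show "maximal_outerplanar (W :: nat set) F \<Longrightarrow> card W = n \<Longrightarrow> MOP n k \<le> spread_number W F k"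
    unfolding MOP_def using fin by (intro Min_le) auto
qed

section \<open>Equivalence with triangulations of a convex polygon\<close>

definition polygon_sides :: "nat \<Rightarrow> nat set set" where
  "polygon_sides n = {{i, Suc i mod n} | i. i < n}"

definition polygon_diagonals :: "nat \<Rightarrow> nat set set" where
  "polygon_diagonals n = {{i, j} | i j. i < j \<and> j < n} - polygon_sides n"

definition polygon_triangulation :: "nat \<Rightarrow> nat set set \<Rightarrow> bool" where
  "polygon_triangulation n T \<longleftrightarrow>
     (\<exists>D \<subseteq> polygon_diagonals n. card D = n - 3 \<and> noncrossing D \<and> T = polygon_sides n \<union> D)"

lemma card_noncrossing_pairs_le:
  fixes P :: "(nat \<times> nat) set"
  assumes "a < b" and "P \<subseteq> {(i, j). a \<le> i \<and> i < j \<and> j \<le> b}"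
    and "\<And>i j k l. (i, j) \<in> P \<Longrightarrow> (k, l) \<in> P \<Longrightarrow> \<not> (i < k \<and> k < j \<and> j < l)"
  shows "card P \<le> 2 * (b - a) - 1"
  using assms
proof (induction "b - a" arbitrary: a b P rule: less_induct)
  case less
  have finP: "finite P"
    by (rule finite_subset[of _ "{a..b} \<times> {a..b}"]) (use less.prems(2) in auto)
  show ?case
  proof (cases "\<exists>j. j < b \<and> (a, j) \<in> P")
    case False
    show ?thesis
    proof (cases "Suc a = b")
      case True
      have "P \<subseteq> {(a, b)}" using less.prems(2) True by auto
      then have "card P \<le> card {(a, b)}" by (intro card_mono) auto
      then show ?thesis using True by auto
    next
      case neq: False
      let ?Q = "P - {(a, b)}"
      have sub: "?Q \<subseteq> {(i, j). Suc a \<le> i \<and> i < j \<and> j \<le> b}"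
      proof
        fix x assume x: "x \<in> ?Q"
        obtain i j where ij: "x = (i, j)" by (cases x)
        have "a \<le> i" "i < j" "j \<le> b" using x ij less.prems(2) by auto
        moreover have "i \<noteq> a" using x ij False \<open>j \<le> b\<close> by auto
        ultimately show "x \<in> {(i, j). Suc a \<le> i \<and> i < j \<and> j \<le> b}" using ij by auto
      qed
      have "card ?Q \<le> 2 * (b - Suc a) - 1"
        by (rule less.hyps) (use neq less.prems sub in auto)
      moreover have "card P \<le> Suc (card ?Q)"
        using finP by (metis card_Diff1_le card_Suc_Diff1 Diff_empty Diff_insert0 le_Suc_eq nle_le)
      ultimately show ?thesis using neq less.prems(1) by linarith
    qed
  next
    case True
    define j where "j = Max {j. j < b \<and> (a, j) \<in> P}"
    have finJ: "finite {j. j < b \<and> (a, j) \<in> P}" by (rule finite_subset[of _ "{..<b}"]) auto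
    have "j \<in> {j. j < b \<and> (a, j) \<in> P}" unfolding j_def using True finJ by (intro Max_in) auto
    then have j: "j < b" "(a, j) \<in> P" by auto
    have jmax: "j' \<le> j" if "j' < b" "(a, j') \<in> P" for j'
      unfolding j_def using finJ that by (intro Max_ge) auto
    have aj: "a < j" using j less.prems(2) by auto
    let ?L = "{(i, l) \<in> P. l \<le> j}" and ?R = "{(i, l) \<in> P. j \<le> i}"
    have cov: "P \<subseteq> insert (a, b) (?L \<union> ?R)"
    proof
      fix x assume x: "x \<in> P"
      obtain i l where il: "x = (i, l)" by (cases x)
      have b: "a \<le> i" "i < l" "l \<le> b" using x il less.prems(2) by auto
      show "x \<in> insert (a, b) (?L \<union> ?R)"
      proof (rule ccontr)
        assume n: "x \<notin> insert (a, b) (?L \<union> ?R)"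
        then have lt: "i < j" "j < l" using x il by auto
        show False
        proof (cases "i = a")
          case True
          then have "l \<noteq> b" using n il by auto
          then show False using jmax[of l] True b x il lt by auto
        next
          case False
          then show False using less.prems(3)[of a j i l] x il lt b j by auto
        qed
      qed
    qed
    have "card ?L \<le> 2 * (j - a) - 1"
      by (rule less.hyps) (use aj j less.prems in auto)
    moreover have "card ?R \<le> 2 * (b - j) - 1"
      by (rule less.hyps) (use aj j less.prems in auto)
    moreover have "card P \<le> Suc (card ?L + card ?R)"
    proof -
      have fL: "finite ?L" "finite ?R" by (auto intro: finite_subset[OF _ finP])
      have "card P \<le> card (insert (a, b) (?L \<union> ?R))" using cov fL by (intro card_mono) auto
      also have "\<dots> \<le> Suc (card (?L \<union> ?R))" by (rule card_insert_le_m1) (auto simp: fL)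
      also have "\<dots> \<le> Suc (card ?L + card ?R)" using card_Un_le by auto
      finally show ?thesis .
    qed
    ultimately show ?thesis using aj j by linarith
  qed
qed

lemma card_maximal_noncrossing_pairs_ge:
  fixes P :: "(nat \<times> nat) set"
  assumes "a < b" and "P \<subseteq> {(i, j). a \<le> i \<and> i < j \<and> j \<le> b}"
    and "\<And>i j k l. (i, j) \<in> P \<Longrightarrow> (k, l) \<in> P \<Longrightarrow> \<not> (i < k \<and> k < j \<and> j < l)"
    and "\<And>i j. a \<le> i \<Longrightarrow> i < j \<Longrightarrow> j \<le> b \<Longrightarrow> (i, j) \<notin> P \<Longrightarrow>
           \<exists>k l. (k, l) \<in> P \<and> (i < k \<and> k < j \<and> j < l \<or> k < i \<and> i < l \<and> l < j)"
  shows "2 * (b - a) - 1 \<le> card P"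
  using assms
proof (induction "b - a" arbitrary: a b P rule: less_induct)
  case less
  have bnd: "a \<le> i \<and> i < j \<and> j \<le> b" if "(i, j) \<in> P" for i j using that less.prems(2) by auto
  have finP: "finite P"
    by (rule finite_subset[of _ "{a..b} \<times> {a..b}"]) (use less.prems(2) in auto)
  have abP: "(a, b) \<in> P"
  proof (rule ccontr)
    assume "(a, b) \<notin> P"
    then obtain k l where "(k, l) \<in> P" "a < k \<and> k < b \<and> b < l \<or> k < a \<and> a < l \<and> l < b"
      using less.prems(4)[of a b] less.prems(1) by auto
    then show False using bnd[of k l] by auto
  qed
  show ?case
  proof (cases "Suc a = b")
    case True
    have "0 < card P" using abP finP by (auto simp: card_gt_0_iff)
    then show ?thesis using True by auto
  next
    case neq: False
    have "(a, Suc a) \<in> P"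
    proof (rule ccontr)
      assume "(a, Suc a) \<notin> P"
      then obtain k l where "(k, l) \<in> P"
          "a < k \<and> k < Suc a \<and> Suc a < l \<or> k < a \<and> a < l \<and> l < Suc a"
        using less.prems(4)[of a "Suc a"] less.prems(1) by auto
      then show False using bnd[of k l] by auto
    qed
    then have ex: "\<exists>j. j < b \<and> (a, j) \<in> P" using neq less.prems(1) by (intro exI[of _ "Suc a"]) auto
    define j where "j = Max {j. j < b \<and> (a, j) \<in> P}"
    have finJ: "finite {j. j < b \<and> (a, j) \<in> P}" by (rule finite_subset[of _ "{..<b}"]) auto
    have "j \<in> {j. j < b \<and> (a, j) \<in> P}" unfolding j_def using ex finJ by (intro Max_in) auto
    then have j: "j < b" "(a, j) \<in> P" by auto
    have jmax: "j' \<le> j" if "j' < b" "(a, j') \<in> P" for j'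
      unfolding j_def using finJ that by (intro Max_ge) auto
    have aj: "a < j" using j bnd by auto
    let ?L = "{(i, l) \<in> P. l \<le> j}" and ?R = "{(i, l) \<in> P. j \<le> i}"
    have split: "(i, l) = (a, b) \<or> l \<le> j \<or> j \<le> i" if "(i, l) \<in> P" for i l
    proof (rule ccontr)
      assume n: "\<not> ?thesis"
      then have lt: "i < j" "j < l" by auto
      show False
      proof (cases "i = a")
        case True
        then show False using jmax[of l] n bnd[OF that] that lt by auto
      next
        case False
        then show False using less.prems(3)[of a j i l] that lt bnd[OF that] j by auto
      qed
    qed
    have "2 * (j - a) - 1 \<le> card ?L"
    proof (rule less.hyps)
      show "j - a < b - a" "a < j" using aj j by auto
      show "?L \<subseteq> {(i, l). a \<le> i \<and> i < l \<and> l \<le> j}" using bnd by auto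
      show "\<not> (i < k \<and> k < m \<and> m < l)" if "(i, m) \<in> ?L" "(k, l) \<in> ?L" for i m k l
        using that less.prems(3)[of i m k l] by auto
      fix i m assume im: "a \<le> i" "i < m" "m \<le> j" "(i, m) \<notin> ?L"
      then obtain k l where kl: "(k, l) \<in> P" "i < k \<and> k < m \<and> m < l \<or> k < i \<and> i < l \<and> l < m"
        using less.prems(4)[of i m] j by auto
      then have "(k, l) \<in> ?L" using split[of k l] im bnd[of k l] by auto
      then show "\<exists>k l. (k, l) \<in> ?L \<and> (i < k \<and> k < m \<and> m < l \<or> k < i \<and> i < l \<and> l < m)"
        using kl by blast
    qed
    moreover have "2 * (b - j) - 1 \<le> card ?R"
    proof (rule less.hyps)
      show "b - j < b - a" "j < b" using aj j by auto
      show "?R \<subseteq> {(i, l). j \<le> i \<and> i < l \<and> l \<le> b}" using bnd by auto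
      show "\<not> (i < k \<and> k < m \<and> m < l)" if "(i, m) \<in> ?R" "(k, l) \<in> ?R" for i m k l
        using that less.prems(3)[of i m k l] by auto
      fix i m assume im: "j \<le> i" "i < m" "m \<le> b" "(i, m) \<notin> ?R"
      then obtain k l where kl: "(k, l) \<in> P" "i < k \<and> k < m \<and> m < l \<or> k < i \<and> i < l \<and> l < m"
        using less.prems(4)[of i m] aj by auto
      then have "(k, l) \<in> ?R" using split[of k l] im bnd[of k l] by auto
      then show "\<exists>k l. (k, l) \<in> ?R \<and> (i < k \<and> k < m \<and> m < l \<or> k < i \<and> i < l \<and> l < m)"
        using kl by blast
    qed
    moreover have "Suc (card ?L + card ?R) \<le> card P"
    proof -
      have fL: "finite ?L" "finite ?R" by (auto intro: finite_subset[OF _ finP])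
      have "?L \<inter> ?R = {}" using bnd by fastforce
      then have "card (?L \<union> ?R) = card ?L + card ?R" using fL by (intro card_Un_disjoint)
      moreover have "(a, b) \<notin> ?L \<union> ?R" using aj j by auto
      ultimately have "card (insert (a, b) (?L \<union> ?R)) = Suc (card ?L + card ?R)"
        using fL by simp
      moreover have "card (insert (a, b) (?L \<union> ?R)) \<le> card P"
        using abP finP by (intro card_mono) auto
      ultimately show ?thesis by linarith
    qed
    ultimately show ?thesis using aj j by linarith
  qed
qed

lemma chords_cross_ordered:
  assumes "i < j" "k < l"
  shows "chords_cross {i, j} {k, l} \<longleftrightarrow> i < k \<and> k < j \<and> j < l"
  using assms unfolding chords_cross_def by (auto simp: doubleton_eq_iff)

definition ordered_pairs :: "nat set set \<Rightarrow> (nat \<times> nat) set" where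
  "ordered_pairs F = {(i, j). i < j \<and> {i, j} \<in> F}"

lemma card_two_ordered:
  assumes "card (e :: nat set) = 2"
  obtains i j where "i < j" "e = {i, j}"
proof -
  obtain x y where "e = {x, y}" "x \<noteq> y" using assms by (meson card_2_iff)
  then show ?thesis using that[of x y] that[of y x] by (cases x y rule: linorder_cases) auto
qed

lemma card_ordered_pairs:
  assumes "\<And>e. e \<in> F \<Longrightarrow> card e = 2"
  shows "card (ordered_pairs F) = card F"
proof -
  have "bij_betw (\<lambda>(i, j). {i, j}) (ordered_pairs F) F"
    unfolding bij_betw_def
  proof
    show "inj_on (\<lambda>(i, j). {i, j}) (ordered_pairs F)"
      by (auto simp: inj_on_def ordered_pairs_def doubleton_eq_iff)
    show "(\<lambda>(i, j). {i, j}) ` ordered_pairs F = F"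
    proof
      show "F \<subseteq> (\<lambda>(i, j). {i, j}) ` ordered_pairs F"
      proof
        fix e assume "e \<in> F"
        then obtain i j where "i < j" "e = {i, j}" using assms card_two_ordered by metis
        then show "e \<in> (\<lambda>(i, j). {i, j}) ` ordered_pairs F"
          using \<open>e \<in> F\<close> by (force simp: ordered_pairs_def)
      qed
    qed (auto simp: ordered_pairs_def)
  qed
  then show ?thesis by (rule bij_betw_same_card)
qed

lemma ordered_pairs_noncrossing:
  assumes "noncrossing F" "(i, j) \<in> ordered_pairs F" "(k, l) \<in> ordered_pairs F"
  shows "\<not> (i < k \<and> k < j \<and> j < l)"
  using assms chords_cross_ordered unfolding noncrossing_def ordered_pairs_def by blast

lemma ordered_pairs_subset:
  assumes "\<And>e. e \<in> F \<Longrightarrow> e \<subseteq> {..<n}"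
  shows "ordered_pairs F \<subseteq> {(i, j). 0 \<le> i \<and> i < j \<and> j \<le> n - 1}"
proof -
  have "j \<le> n - 1" if "{i, j} \<in> F" for i j using assms[OF that] by auto
  then show ?thesis by (auto simp: ordered_pairs_def)
qed

lemma card_noncrossing_le:
  assumes "2 \<le> n" "\<And>e. e \<in> F \<Longrightarrow> e \<subseteq> {..<n} \<and> card e = 2" "noncrossing F"
  shows "card F \<le> 2 * n - 3"
proof -
  have "card (ordered_pairs F) \<le> 2 * (n - 1 - 0) - 1"
    by (rule card_noncrossing_pairs_le)
       (use assms ordered_pairs_subset[of F n] ordered_pairs_noncrossing[of F] in auto)
  then show ?thesis using card_ordered_pairs[of F] assms by auto
qed

lemma card_maximal_noncrossing:
  assumes "2 \<le> n" "\<And>e. e \<in> F \<Longrightarrow> e \<subseteq> {..<n} \<and> card e = 2" "noncrossing F"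
    and max: "\<And>i j. i < j \<Longrightarrow> j < n \<Longrightarrow> {i, j} \<notin> F \<Longrightarrow> \<not> noncrossing (insert {i, j} F)"
  shows "card F = 2 * n - 3"
proof -
  have "2 * (n - 1 - 0) - 1 \<le> card (ordered_pairs F)"
  proof (rule card_maximal_noncrossing_pairs_ge)
    show "0 < n - 1" using assms by auto
    show "ordered_pairs F \<subseteq> {(i, j). 0 \<le> i \<and> i < j \<and> j \<le> n - 1}"
      using ordered_pairs_subset assms(2) by blast
    show "\<not> (i < k \<and> k < j \<and> j < l)"
      if "(i, j) \<in> ordered_pairs F" "(k, l) \<in> ordered_pairs F" for i j k l
      using ordered_pairs_noncrossing[OF assms(3) that] .
    fix i j :: nat assume ij: "i < j" "j \<le> n - 1" "(i, j) \<notin> ordered_pairs F"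
    then have "{i, j} \<notin> F" by (auto simp: ordered_pairs_def)
    then have "\<not> noncrossing (insert {i, j} F)" using max ij by auto
    moreover have "\<not> chords_cross {i, j} {i, j}" using chords_cross_ordered ij(1) by auto
    ultimately obtain e where e: "e \<in> F" "chords_cross {i, j} e \<or> chords_cross e {i, j}"
      using assms(3) unfolding noncrossing_def by blast
    obtain k l where kl: "k < l" "e = {k, l}" using e(1) assms(2) card_two_ordered by metis
    then have "(k, l) \<in> ordered_pairs F" using e(1) by (auto simp: ordered_pairs_def)
    moreover have "i < k \<and> k < j \<and> j < l \<or> k < i \<and> i < l \<and> l < j"
      using e(2) kl ij(1) chords_cross_ordered by auto
    ultimately show "\<exists>k l. (k, l) \<in> ordered_pairs F \<and>
        (i < k \<and> k < j \<and> j < l \<or> k < i \<and> i < l \<and> l < j)" by blast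
  qed
  then have "2 * n - 3 \<le> card F" using card_ordered_pairs[of F] assms(1,2) by auto
  then show ?thesis using card_noncrossing_le[OF assms(1-3)] by auto
qed

lemma polygon_sides_eq:
  assumes "3 \<le> n"
  shows "polygon_sides n = insert {0, n - 1} ((\<lambda>i. {i, Suc i}) ` {..<n - 1})"
proof -
  have "{i, Suc i mod n} = (if i = n - 1 then {0, n - 1} else {i, Suc i})" if "i < n" for i
    using that assms by auto
  then have *: "(\<lambda>i. {i, Suc i mod n}) ` {..<n} =
      (\<lambda>i. if i = n - 1 then {0, n - 1} else {i, Suc i}) ` {..<n}"
    by (intro image_cong) simp_all
  have "polygon_sides n = (\<lambda>i. {i, Suc i mod n}) ` {..<n}"
    unfolding polygon_sides_def by blast
  also note *
  also have "{..<n} = insert (n - 1) {..<n - 1}" using assms by auto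
  also have "(\<lambda>i. if i = n - 1 then {0, n - 1} else {i, Suc i}) ` insert (n - 1) {..<n - 1}
      = insert {0, n - 1} ((\<lambda>i. {i, Suc i}) ` {..<n - 1})"
    by (auto simp: image_iff)
  finally show ?thesis .
qed

lemma card_polygon_sides:
  assumes "3 \<le> n"
  shows "card (polygon_sides n) = n"
proof -
  have "inj_on (\<lambda>i. {i, Suc i}) {..<n - 1}" by (auto simp: inj_on_def doubleton_eq_iff)
  then have "card ((\<lambda>i. {i, Suc i}) ` {..<n - 1}) = n - 1" by (simp add: card_image)
  moreover have "{0, n - 1} \<notin> (\<lambda>i. {i, Suc i}) ` {..<n - 1}"
    using assms by (auto simp: doubleton_eq_iff)
  ultimately show ?thesis using assms by (simp add: polygon_sides_eq)
qed

lemma polygon_side_ordered: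
  assumes "3 \<le> n" "e \<in> polygon_sides n"
  obtains i j where "i < j" "j < n" "e = {i, j}" "j = Suc i \<or> i = 0 \<and> j = n - 1"
  using assms(2) unfolding polygon_sides_eq[OF assms(1)]
proof
  assume "e = {0, n - 1}"
  then show ?thesis using that[of 0 "n - 1"] assms(1) by auto
next
  assume "e \<in> (\<lambda>i. {i, Suc i}) ` {..<n - 1}"
  then obtain i where "i < n - 1" "e = {i, Suc i}" by auto
  then show ?thesis using that[of i "Suc i"] by auto
qed

lemma polygon_side_not_crossed:
  assumes "3 \<le> n" "e \<in> polygon_sides n" "e' \<subseteq> {..<n}" "card e' = 2"
  shows "\<not> chords_cross e e'" "\<not> chords_cross e' e"
proof -
  obtain i j where ij: "i < j" "j < n" "e = {i, j}" "j = Suc i \<or> i = 0 \<and> j = n - 1"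
    using polygon_side_ordered[OF assms(1,2)] by metis
  obtain k l where kl: "k < l" "e' = {k, l}" using assms(4) card_two_ordered by metis
  then have "l < n" using assms(3) by auto
  then show "\<not> chords_cross e e'" "\<not> chords_cross e' e"
    using ij kl chords_cross_ordered[of i j k l] chords_cross_ordered[of k l i j] by auto
qed

lemma chord_of_polygon:
  assumes "3 \<le> n" "e \<in> polygon_sides n \<union> polygon_diagonals n"
  shows "e \<subseteq> {..<n} \<and> card e = 2"
proof -
  have "\<exists>i j. i < j \<and> j < n \<and> e = {i, j}"
    using assms(2) polygon_side_ordered[OF assms(1), of e] unfolding polygon_diagonals_def by blast
  then show ?thesis by auto
qed

lemma image_edge:
  assumes "simple_graph V E" "bij_betw f V {..<n}" "e \<in> (`) f ` E"
  shows "e \<subseteq> {..<n} \<and> card e = 2"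
proof -
  obtain d where d: "d \<in> E" "e = f ` d" using assms(3) by auto
  then have "d \<subseteq> V" "card d = 2" using assms(1) by (auto simp: simple_graph_def)
  moreover have "inj_on f d"
    using assms(2) \<open>d \<subseteq> V\<close> by (meson bij_betw_imp_inj_on inj_on_subset)
  ultimately show ?thesis using assms(2) d(2) by (auto simp: card_image bij_betw_def)
qed

lemma card_image_edges:
  assumes "simple_graph V E" "bij_betw f V {..<n}"
  shows "card ((`) f ` E) = card E"
proof (rule card_image)
  have "inj_on ((`) f) (Pow V)" using assms(2) by (simp add: bij_betw_def inj_on_image_Pow)
  then show "inj_on ((`) f) E"
    by (rule inj_on_subset) (use assms(1) in \<open>auto simp: simple_graph_def\<close>)
qed

theorem maximal_outerplanar_iff_triangulation:
  assumes "card V = n" "3 \<le> n"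
  shows "maximal_outerplanar V E \<longleftrightarrow> simple_graph V E \<and>
    (\<exists>f. bij_betw f V {..<n} \<and> polygon_triangulation n ((`) f ` E))"
proof
  assume max: "maximal_outerplanar V E"
  then have sg: "simple_graph V E"
    by (simp add: maximal_outerplanar_def outerplanar_def)
  obtain f where f: "bij_betw f V {..<n}" and nc: "noncrossing ((`) f ` E)"
    using max assms(1) by (auto simp: maximal_outerplanar_def outerplanar_def)
  have maxE: "\<not> outerplanar V (insert {u, v} E)" if "u \<in> V" "v \<in> V" "u \<noteq> v" "{u, v} \<notin> E" for u v
    using max that by (simp add: maximal_outerplanar_def)
  let ?F = "(`) f ` E"
  have edge: "e \<subseteq> {..<n} \<and> card e = 2" if "e \<in> ?F" for e using image_edge[OF sg f that] .
  have maxF: "\<not> noncrossing (insert {i, j} ?F)" if ij: "i < j" "j < n" "{i, j} \<notin> ?F" for i j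
  proof
    assume n: "noncrossing (insert {i, j} ?F)"
    have "i \<in> f ` V" "j \<in> f ` V" using f ij by (auto simp: bij_betw_def)
    then obtain u v where uv: "u \<in> V" "v \<in> V" "f u = i" "f v = j" by blast
    have "u \<noteq> v" using uv ij(1) by auto
    moreover have "{u, v} \<notin> E"
    proof
      assume "{u, v} \<in> E"
      then have "f ` {u, v} \<in> ?F" by (rule imageI)
      then show False using uv ij(3) by simp
    qed
    moreover have "outerplanar V (insert {u, v} E)"
      unfolding outerplanar_def
      using sg uv \<open>u \<noteq> v\<close> f n assms(1) by (auto simp: simple_graph_def intro!: exI[of _ f])
    ultimately show False
      using maxE uv(1,2) \<open>u \<noteq> v\<close> by metis
  qed
  have cardF: "card ?F = 2 * n - 3"
    by (rule card_maximal_noncrossing) (use assms(2) edge nc maxF in auto)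
  have sides: "polygon_sides n \<subseteq> ?F"
  proof
    fix e assume e: "e \<in> polygon_sides n"
    show "e \<in> ?F"
    proof (rule ccontr)
      assume "e \<notin> ?F"
      moreover obtain i j where "i < j" "j < n" "e = {i, j}"
        using polygon_side_ordered[OF assms(2) e] by metis
      ultimately have "\<not> noncrossing (insert e ?F)" using maxF by auto
      moreover have "e \<subseteq> {..<n} \<and> card e = 2" using chord_of_polygon assms(2) e by blast
      ultimately show False
        using nc polygon_side_not_crossed[OF assms(2) e] edge unfolding noncrossing_def by blast
    qed
  qed
  have "finite ?F" using cardF assms(2) by (intro card_ge_0_finite) auto
  then have "card (?F - polygon_sides n) = n - 3"
    using sides cardF card_polygon_sides[OF assms(2)] assms(2)
    by (simp add: card_Diff_subset finite_subset)
  moreover have "?F - polygon_sides n \<subseteq> polygon_diagonals n"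
  proof
    fix e assume e: "e \<in> ?F - polygon_sides n"
    then obtain i j where "i < j" "e = {i, j}" using edge card_two_ordered by (metis DiffD1)
    then show "e \<in> polygon_diagonals n" using e edge[of e] by (auto simp: polygon_diagonals_def)
  qed
  moreover have "noncrossing (?F - polygon_sides n)" using nc by (auto simp: noncrossing_def)
  ultimately have "polygon_triangulation n ?F"
    unfolding polygon_triangulation_def using sides
    by (intro exI[of _ "?F - polygon_sides n"]) auto
  then show "simple_graph V E \<and> (\<exists>f. bij_betw f V {..<n} \<and> polygon_triangulation n ((`) f ` E))"
    using sg f by blast
next
  assume asm: "simple_graph V E \<and>
    (\<exists>f. bij_betw f V {..<n} \<and> polygon_triangulation n ((`) f ` E))"
  then have sg: "simple_graph V E" ..
  from asm obtain f where f: "bij_betw f V {..<n}" and "polygon_triangulation n ((`) f ` E)"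
    by (elim conjE exE)
  then obtain D where D: "D \<subseteq> polygon_diagonals n" "card D = n - 3" "noncrossing D"
      "(`) f ` E = polygon_sides n \<union> D"
    unfolding polygon_triangulation_def by (elim conjE exE)
  have edge: "e \<subseteq> {..<n} \<and> card e = 2" if "e \<in> polygon_sides n \<union> D" for e
    by (rule chord_of_polygon[OF assms(2)]) (use that D(1) in blast)
  have "noncrossing (polygon_sides n \<union> D)"
    unfolding noncrossing_def
  proof (intro ballI)
    fix e e' assume e: "e \<in> polygon_sides n \<union> D" "e' \<in> polygon_sides n \<union> D"
    show "\<not> chords_cross e e'"
    proof (cases "e \<in> polygon_sides n \<or> e' \<in> polygon_sides n")
      case True
      then show ?thesis
        using polygon_side_not_crossed(1)[OF assms(2), of e e']
          polygon_side_not_crossed(2)[OF assms(2), of e' e] edge[OF e(1)] edge[OF e(2)] by auto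
    next
      case False
      then show ?thesis using e D(3) by (simp add: noncrossing_def)
    qed
  qed
  then have op: "outerplanar V E"
    unfolding outerplanar_def D(4)[symmetric] assms(1) using sg f by blast
  have finE: "finite E"
    by (rule finite_subset[of _ "Pow V"]) (use sg in \<open>auto simp: simple_graph_def\<close>)
  have "finite (polygon_sides n \<union> D)" using finE by (simp flip: D(4))
  then have fin: "finite (polygon_sides n)" "finite D" by simp_all
  have "card E = card (polygon_sides n \<union> D)" using card_image_edges[OF sg f] D(4) by simp
  also have "\<dots> = card (polygon_sides n) + card D"
    using fin D(1) by (intro card_Un_disjoint) (auto simp: polygon_diagonals_def)
  finally have cardE: "card E = 2 * n - 3"
    using card_polygon_sides[OF assms(2)] D(2) assms(2) by auto
  have "\<not> outerplanar V (insert {u, v} E)" if "{u, v} \<notin> E" for u v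
  proof
    assume "outerplanar V (insert {u, v} E)"
    then obtain g where sg': "simple_graph V (insert {u, v} E)"
      and g: "bij_betw g V {..<n}" "noncrossing ((`) g ` insert {u, v} E)"
      unfolding outerplanar_def assms(1) by blast
    have "card ((`) g ` insert {u, v} E) \<le> 2 * n - 3"
    proof (rule card_noncrossing_le)
      show "2 \<le> n" using assms(2) by simp
      show "e \<subseteq> {..<n} \<and> card e = 2" if "e \<in> (`) g ` insert {u, v} E" for e
        using image_edge[OF sg' g(1) that] .
    qed (rule g(2))
    then have "card (insert {u, v} E) \<le> 2 * n - 3" using card_image_edges[OF sg' g(1)] by simp
    moreover have "card (insert {u, v} E) = Suc (2 * n - 3)" using that finE cardE by simp
    ultimately show False by simp
  qed
  then show "maximal_outerplanar V E" using op by (auto simp: maximal_outerplanar_def)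
qed

end

theory Submission
  imports Defs "HOL-Library.Multiset"
begin

text \<open>Let \<open>n\<^sub>d\<close> be the number of vertices of degree \<open>d\<close> and \<open>s\<close> the largest number of vertices with
  degrees in an interval \<open>[j, j + 2]\<close>. The degrees sum to \<open>4 n - 6\<close>. Weighting the intervals
  starting at \<open>2\<close>, \<open>3\<close> and \<open>5\<close> by \<open>6\<close>, \<open>1\<close> and \<open>2\<close> counts a vertex of degree \<open>d\<close> at least
  \<open>8 - d\<close> times, and twice more if \<open>d\<close> is \<open>3\<close> or \<open>4\<close>; hence \<open>9 s \<ge> 4 n + 6 + 2 (n\<^sub>3 + n\<^sub>4)\<close>.
  Finally \<open>n\<^sub>3 + n\<^sub>4 \<ge> 2\<close>, because removing all vertices of degree \<open>2\<close> leaves a MOP whose vertices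
  of degree \<open>2\<close> had degree \<open>3\<close> or \<open>4\<close> before. Equality forces \<open>n\<^sub>3 = 2\<close> and \<open>n\<^sub>4 = 0\<close>, so that the
  remaining MOP is a strip; periodic strips with ears attain the bound for \<open>n = 18 k + 2\<close>, and each
  additional ear increases \<open>s\<close> by at most \<open>3\<close>.\<close>

section \<open>Triangulations as binary trees\<close>

text \<open>A tree describes a triangulation of a polygon with a distinguished base: \<open>Side\<close> is the
  degenerate polygon consisting of its base only, and in \<open>Tri l r\<close> the two other sides of the
  triangle at the base are the bases of \<open>l\<close> and \<open>r\<close>.\<close>

datatype triang = Side | Tri triang triang

primrec sides :: "triang \<Rightarrow> nat" where
  "sides Side = 1"
| "sides (Tri l r) = sides l + sides r"

text \<open>Degree of the left end of the base, the base included. Gluing changes only the degrees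
  of base ends, so these are kept apart from \<open>inner\<close>, whose entries are final.\<close>

primrec ldeg :: "triang \<Rightarrow> nat" where
  "ldeg Side = 1"
| "ldeg (Tri l r) = Suc (ldeg l)"

primrec rdeg :: "triang \<Rightarrow> nat" where
  "rdeg Side = 1"
| "rdeg (Tri l r) = Suc (rdeg r)"

primrec inner :: "triang \<Rightarrow> nat multiset" where
  "inner Side = {#}"
| "inner (Tri l r) = add_mset (rdeg l + ldeg r) (inner l + inner r)"

definition degs :: "triang \<Rightarrow> nat multiset" where
  "degs t = add_mset (ldeg t) (add_mset (rdeg t) (inner t))"

text \<open>The corners of \<open>t\<close> are numbered consecutively from \<open>a\<close> to
  \<open>a + sides t\<close>, the base joining the first to the last.\<close>

primrec chords :: "nat \<Rightarrow> triang \<Rightarrow> (nat \<times> nat) set" where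
  "chords a Side = {(a, Suc a)}"
| "chords a (Tri l r) = insert (a, a + (sides l + sides r)) (chords a l \<union> chords (a + sides l) r)"

lemma sides_pos: "0 < sides t"
  by (induction t) auto

lemma ldeg_pos: "0 < ldeg t" and rdeg_pos: "0 < rdeg t"
  by (induction t) auto

lemma size_degs: "size (degs t) = Suc (sides t)"
proof -
  have "Suc (size (inner t)) = sides t" by (induction t) auto
  then show ?thesis by (simp add: degs_def)
qed

text \<open>With \<open>n = sides t + 1\<close> corners this is twice the number
  \<open>2 * n - 3\<close> of edges.\<close>

lemma sum_degs: "sum_mset (degs t) + 2 = 4 * sides t"
  by (induction t) (auto simp: degs_def)

lemma inner_ge_2: "d \<in># inner t \<Longrightarrow> 2 \<le> d"
proof (induction t)
  case (Tri l r)
  then show ?case using rdeg_pos[of l] ldeg_pos[of r] by auto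
qed auto

lemma degs_ge_2:
  assumes "2 \<le> sides t" "d \<in># degs t"
  shows "2 \<le> d"
proof -
  obtain l r where "t = Tri l r" using assms(1) by (cases t) auto
  then show ?thesis
    using assms(2) inner_ge_2[of d t] ldeg_pos[of l] rdeg_pos[of r] by (auto simp: degs_def)
qed

lemma sides_1: "sides t = Suc 0 \<Longrightarrow> t = Side"
proof (cases t)
  case (Tri l r)
  moreover assume "sides t = Suc 0"
  ultimately show ?thesis using sides_pos[of l] sides_pos[of r] by simp
qed

lemma sides_2: "sides t = 2 \<Longrightarrow> t = Tri Side Side"
proof (cases t)
  case (Tri l r)
  moreover assume "sides t = 2"
  moreover have "sides l = 1 \<and> sides r = 1"
    using calculation sides_pos[of l] sides_pos[of r] by simp
  ultimately show ?thesis using sides_1 by simp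
qed simp

lemma sides_cases:
  obtains "t = Side" | "t = Tri Side Side" | "3 \<le> sides t"
proof (cases "3 \<le> sides t")
  case False
  then have "sides t = 1 \<or> sides t = 2" using sides_pos[of t] by linarith
  then show ?thesis using that sides_1 sides_2 by auto
qed (rule that)

section \<open>The lower bound\<close>

abbreviation count34 :: "nat multiset \<Rightarrow> nat" where
  "count34 M \<equiv> size (filter_mset (\<lambda>d. d = 3 \<or> d = 4) M)"

text \<open>Either a part has at least three sides and the induction applies to it, or both parts
  are sides or ears, not both sides, and the apex has degree 3 or 4.\<close>

lemma count34_inner: "3 \<le> sides t \<Longrightarrow> 1 \<le> count34 (inner t)"
proof (induction t)
  case (Tri l r)
  show ?case
    by (cases l rule: sides_cases; cases r rule: sides_cases) (use Tri in auto)
qed simp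

text \<open>A part with at least three sides contributes an inner vertex; a part that is an ear
  contributes its end of the base, of degree 3.\<close>

lemma count34_degs:
  assumes "4 \<le> sides t"
  shows "2 \<le> count34 (degs t)"
proof -
  obtain l r where t: "t = Tri l r" using assms by (cases t) auto
  \<comment> \<open>The left end of the base now has degree 2, so one looks a triangle deeper:
    \<open>p\<close> and \<open>q\<close> each contribute an inner vertex or, if they are sides or
    ears, their end of the base of \<open>r\<close>.\<close>
  have Side_l: "2 \<le> count34 (degs (Tri Side r))" if ge: "3 \<le> sides r" for r
  proof -
    obtain p q where r: "r = Tri p q" using ge by (cases r) auto
    show ?thesis
      by (cases p rule: sides_cases; cases q rule: sides_cases)
         (use ge count34_inner[of p] count34_inner[of q] in \<open>auto simp: r degs_def\<close>)
  qed
  have Side_r: "2 \<le> count34 (degs (Tri l Side))" if ge: "3 \<le> sides l" for l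
  proof -
    obtain p q where l: "l = Tri p q" using ge by (cases l) auto
    show ?thesis
      by (cases p rule: sides_cases; cases q rule: sides_cases)
         (use ge count34_inner[of p] count34_inner[of q] in \<open>auto simp: l degs_def\<close>)
  qed
  show ?thesis
    unfolding t
    by (cases l rule: sides_cases; cases r rule: sides_cases)
       (use assms Side_l Side_r count34_inner[of l] count34_inner[of r] in
         \<open>auto simp: t degs_def\<close>)
qed

definition window :: "nat \<Rightarrow> nat multiset \<Rightarrow> nat" where
  "window j M = size (filter_mset (\<lambda>d. j \<le> d \<and> d \<le> j + 2) M)"

text \<open>The inequality holds vertex by vertex, with equality exactly for the degrees 2, 3, 5, 6
  and 8; the extremal triangulations below have only these degrees.\<close>

lemma windows_lower_bound:
  assumes "\<And>d. d \<in># M \<Longrightarrow> 2 \<le> d"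
  shows "8 * size M + 2 * count34 M \<le> 6 * window 2 M + window 3 M + 2 * window 5 M + sum_mset M"
  using assms
proof (induction M)
  case (add d M)
  have "2 \<le> d" using add.prems by simp
  then consider "d = 2" | "d = 3" | "d = 4" | "d = 5" | "d = 6" | "d = 7" | "8 \<le> d" by linarith
  then show ?case using add by cases (auto simp: window_def)
qed (simp add: window_def)

lemma degs_window_lower_bound:
  assumes "4 \<le> sides t" "\<And>j. window j (degs t) \<le> s"
  shows "4 * Suc (sides t) + 10 \<le> 9 * s"
  using windows_lower_bound[of "degs t"] degs_ge_2[of t] count34_degs[OF assms(1)] assms(1)
    assms(2)[of 2] assms(2)[of 3] assms(2)[of 5] sum_degs[of t] size_degs[of t]
  by auto

section \<open>Binary trees and maximal sets of noncrossing chords\<close>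

lemma chords_bounds: "(i, j) \<in> chords a t \<Longrightarrow> a \<le> i \<and> i < j \<and> j \<le> a + sides t"
proof (induction t arbitrary: a)
  case (Tri l r)
  then show ?case using sides_pos[of l] by fastforce
qed simp

lemma finite_chords [simp]: "finite (chords a t)"
  by (induction t arbitrary: a) auto

lemma base_notin_chords:
  "(a, a + (sides l + sides r)) \<notin> chords a l \<union> chords (a + sides l) r"
  using chords_bounds[of a "a + (sides l + sides r)" a l]
    chords_bounds[of a "a + (sides l + sides r)" "a + sides l" r] sides_pos[of l] sides_pos[of r]
  by auto

lemma chords_disjoint: "chords a l \<inter> chords (a + sides l) r = {}"
proof -
  have False if "(i, j) \<in> chords a l" "(i, j) \<in> chords (a + sides l) r" for i j
    using that chords_bounds[of i j a l] chords_bounds[of i j "a + sides l" r] by linarith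
  then show ?thesis by auto
qed

lemma card_chords: "Suc (card (chords a t)) = 2 * sides t"
proof (induction t arbitrary: a)
  case (Tri l r)
  have "card (chords a (Tri l r)) = Suc (card (chords a l) + card (chords (a + sides l) r))"
    using base_notin_chords[of a l r] chords_disjoint[of a l r] by (simp add: card_Un_disjoint)
  then show ?case using Tri.IH(1)[of a] Tri.IH(2)[of "a + sides l"] by simp
qed simp

lemma chords_noncrossing:
  "(i, j) \<in> chords a t \<Longrightarrow> (k, l) \<in> chords a t \<Longrightarrow> \<not> (i < k \<and> k < j \<and> j < l)"
proof (induction t arbitrary: a)
  case (Tri p q)
  show ?case
    using Tri.prems Tri.IH(1)[of a] Tri.IH(2)[of "a + sides p"] chords_bounds[of i j a p]
      chords_bounds[of k l a p] chords_bounds[of i j "a + sides p" q]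
      chords_bounds[of k l "a + sides p" q]
    by auto
qed auto

text \<open>The other side \<open>(a, j)\<close> of the triangle at the base \<open>(a, b)\<close> splits \<open>P\<close>; since \<open>P\<close> has
  the largest possible size, so have both parts.\<close>

lemma full_noncrossing_chords:
  fixes P :: "(nat \<times> nat) set"
  assumes "a < b" and "P \<subseteq> {(i, j). a \<le> i \<and> i < j \<and> j \<le> b}"
    and "\<And>i j k l. (i, j) \<in> P \<Longrightarrow> (k, l) \<in> P \<Longrightarrow> \<not> (i < k \<and> k < j \<and> j < l)"
    and "card P = 2 * (b - a) - 1"
  shows "\<exists>t. sides t = b - a \<and> P = chords a t"
  using assms
proof (induction "b - a" arbitrary: a b P rule: less_induct)
  case less
  have bnd: "a \<le> i \<and> i < j \<and> j \<le> b" if "(i, j) \<in> P" for i j using that less.prems(2) by auto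
  have finP: "finite P"
    by (rule finite_subset[of _ "{a..b} \<times> {a..b}"]) (use less.prems(2) in auto)
  show ?case
  proof (cases "Suc a = b")
    case True
    have "P \<subseteq> {(a, b)}" using bnd True by force
    moreover have "P \<noteq> {}" using less.prems(4) True by auto
    ultimately have "P = {(a, b)}" by blast
    then show ?thesis using True by (intro exI[of _ Side]) auto
  next
    case neq: False
    \<comment> \<open>Otherwise all chords but the base avoid \<open>a\<close>, and \<open>P\<close>
      has at most \<open>2 * (b - a) - 2\<close> elements.\<close>
    have ex: "\<exists>j. j < b \<and> (a, j) \<in> P"
    proof (rule ccontr)
      assume no: "\<not> ?thesis"
      let ?Q = "P - {(a, b)}"
      have "Suc a \<le> i \<and> i < j \<and> j \<le> b" if "(i, j) \<in> ?Q" for i j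
        using that bnd[of i j] no by (cases "i = a"; cases "j = b") auto
      then have Q: "?Q \<subseteq> {(i, j). Suc a \<le> i \<and> i < j \<and> j \<le> b}" by blast
      have "card ?Q \<le> 2 * (b - Suc a) - 1"
        by (rule card_noncrossing_pairs_le) (use neq less.prems Q in auto)
      moreover have "card P \<le> Suc (card ?Q)"
        by (auto simp: card_Diff_singleton_if)
      ultimately show False using neq less.prems(1,4) by linarith
    qed
    define j where "j = Max {j. j < b \<and> (a, j) \<in> P}"
    have finJ: "finite {j. j < b \<and> (a, j) \<in> P}" by (rule finite_subset[of _ "{..<b}"]) auto
    have "j \<in> {j. j < b \<and> (a, j) \<in> P}" unfolding j_def using ex finJ by (intro Max_in) auto
    then have j: "j < b" "(a, j) \<in> P" by auto
    have jmax: "j' \<le> j" if "j' < b" "(a, j') \<in> P" for j'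
      unfolding j_def using finJ that by (intro Max_ge) auto
    have aj: "a < j" using j bnd by auto
    let ?L = "{(i, l) \<in> P. l \<le> j}" and ?R = "{(i, l) \<in> P. j \<le> i}"
    \<comment> \<open>A chord straddling \<open>j\<close> either crosses \<open>(a, j)\<close> or
      starts at \<open>a\<close>; in the latter case the choice of \<open>j\<close> leaves only the
      base.\<close>
    have split: "(i, l) = (a, b) \<or> l \<le> j \<or> j \<le> i" if "(i, l) \<in> P" for i l
      using less.prems(3)[of a j i l] jmax[of l] bnd[OF that] that j(2) by fastforce
    then have sub: "P \<subseteq> insert (a, b) (?L \<union> ?R)" by auto
    have fin: "finite ?L" "finite ?R" by (auto intro: finite_subset[OF _ finP])
    have L: "?L \<subseteq> {(i, l). a \<le> i \<and> i < l \<and> l \<le> j}"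
      and R: "?R \<subseteq> {(i, l). j \<le> i \<and> i < l \<and> l \<le> b}"
      using bnd by auto
    have ncL: "\<not> (i < k \<and> k < m \<and> m < l)" if "(i, m) \<in> ?L" "(k, l) \<in> ?L" for i m k l
      using that less.prems(3)[of i m k l] by auto
    have ncR: "\<not> (i < k \<and> k < m \<and> m < l)" if "(i, m) \<in> ?R" "(k, l) \<in> ?R" for i m k l
      using that less.prems(3)[of i m k l] by auto
    have leL: "card ?L \<le> 2 * (j - a) - 1"
      by (rule card_noncrossing_pairs_le[OF aj L ncL])
    have leR: "card ?R \<le> 2 * (b - j) - 1"
      by (rule card_noncrossing_pairs_le[OF j(1) R ncR])
    have le: "card (?L \<union> ?R) \<le> card ?L + card ?R" by (rule card_Un_le)
    \<comment> \<open>The bounds for the two parts add up to \<open>2 * (b - a) - 2\<close>, one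
      less than \<open>card P\<close>: the base must be present and neither part can be
      smaller.\<close>
    have abP: "(a, b) \<in> P"
    proof (rule ccontr)
      assume "(a, b) \<notin> P"
      then have "P \<subseteq> ?L \<union> ?R" using sub by blast
      then have "card P \<le> card (?L \<union> ?R)" using fin by (intro card_mono) auto
      then show False using le leL leR less.prems(4) aj j(1) by linarith
    qed
    then have P: "P = insert (a, b) (?L \<union> ?R)" using sub by auto
    have "card P \<le> Suc (card (?L \<union> ?R))"
      by (subst P) (rule card_insert_le_m1, use fin in auto)
    then have full: "card ?L = 2 * (j - a) - 1" "card ?R = 2 * (b - j) - 1"
      using le leL leR less.prems(4) aj j(1) by linarith+
    have "\<exists>t. sides t = j - a \<and> ?L = chords a t"
      by (rule less.hyps[OF _ aj L ncL full(1)]) (use j aj in auto)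
    moreover have "\<exists>t. sides t = b - j \<and> ?R = chords j t"
      by (rule less.hyps[OF _ j(1) R ncR full(2)]) (use j aj in auto)
    ultimately obtain s t where st: "sides s = j - a" "?L = chords a s"
        "sides t = b - j" "?R = chords j t"
      by (elim exE conjE)
    have "P = chords a (Tri s t)"
      using aj j(1) st(1,3) P[unfolded st(2,4)] by simp
    then show ?thesis using aj j(1) st(1,3) by (intro exI[of _ "Tri s t"]) auto
  qed
qed

section \<open>Degrees in a set of ordered chords\<close>

definition pdeg :: "(nat \<times> nat) set \<Rightarrow> nat \<Rightarrow> nat" where
  "pdeg P v = card {(i, j) \<in> P. v = i \<or> v = j}"

lemma pdeg_insert:
  assumes "finite P" "(i, j) \<notin> P"
  shows "pdeg (insert (i, j) P) v = pdeg P v + (if v = i \<or> v = j then 1 else 0)"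
proof -
  let ?I = "\<lambda>P. {(i, j) \<in> P. v = i \<or> v = j}"
  have "?I (insert (i, j) P) = (if v = i \<or> v = j then insert (i, j) (?I P) else ?I P)" by auto
  moreover have "finite (?I P)" by (rule finite_subset[OF _ assms(1)]) auto
  ultimately show ?thesis using assms(2) by (auto simp: pdeg_def)
qed

lemma pdeg_Un:
  assumes "finite P" "finite Q" "P \<inter> Q = {}"
  shows "pdeg (P \<union> Q) v = pdeg P v + pdeg Q v"
proof -
  let ?I = "\<lambda>P. {(i, j) \<in> P. v = i \<or> v = j}"
  have "?I (P \<union> Q) = ?I P \<union> ?I Q" by auto
  moreover have "finite (?I P)" "finite (?I Q)" "?I P \<inter> ?I Q = {}"
    using assms(3) by (auto intro: finite_subset[OF _ assms(1)] finite_subset[OF _ assms(2)])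
  ultimately show ?thesis by (simp add: pdeg_def card_Un_disjoint)
qed

lemma pdeg_Tri:
  "pdeg (chords a (Tri l r)) v = pdeg (chords a l) v + pdeg (chords (a + sides l) r) v
     + (if v = a \<or> v = a + (sides l + sides r) then 1 else 0)"
  using base_notin_chords[of a l r] chords_disjoint[of a l r]
  by (simp add: pdeg_insert pdeg_Un)

lemma pdeg_outside:
  assumes "v < a \<or> a + sides t < v"
  shows "pdeg (chords a t) v = 0"
proof -
  have "{(i, j) \<in> chords a t. v = i \<or> v = j} = {}" using assms chords_bounds by fastforce
  then show ?thesis by (simp only: pdeg_def card.empty)
qed

lemma pdeg_left: "pdeg (chords a t) a = ldeg t"
proof (induction t)
  case Side
  then show ?case using pdeg_insert[of "{}" a "Suc a" a] by (simp add: pdeg_def)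
next
  case (Tri l r)
  then show ?case unfolding pdeg_Tri using pdeg_outside[of a "a + sides l" r] sides_pos[of l] by simp
qed

lemma pdeg_right: "pdeg (chords a t) (a + sides t) = rdeg t"
proof (induction t arbitrary: a)
  case Side
  then show ?case using pdeg_insert[of "{}" a "Suc a" "Suc a"] by (simp add: pdeg_def)
next
  case (Tri l r)
  then show ?case
    unfolding pdeg_Tri using pdeg_outside[of "a + (sides l + sides r)" a l] sides_pos[of r]
      Tri.IH(2)[of "a + sides l"]
    by (simp add: add.assoc)
qed

text \<open>The apex separates the inner corners of the two parts, and no chord of one part or the
  base ends at an inner corner of the other.\<close>

lemma image_pdeg_inner:
  "image_mset (pdeg (chords a t)) (mset_set {a<..<a + sides t}) = inner t"
proof (induction t arbitrary: a)
  case Side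
  have "{a<..<Suc a} = {}" by auto
  then show ?case by simp
next
  case (Tri l r)
  let ?m = "a + sides l" and ?b = "a + (sides l + sides r)" and ?P = "chords a (Tri l r)"
  have "{a<..<?b} = insert ?m ({a<..<?m} \<union> {?m<..<?b})"
    using sides_pos[of l] sides_pos[of r] by auto
  then have "mset_set {a<..<?b} = add_mset ?m (mset_set {a<..<?m} + mset_set {?m<..<?b})"
    by (simp add: mset_set_Union)
  moreover have "pdeg ?P ?m = rdeg l + ldeg r"
    unfolding pdeg_Tri using pdeg_right[of a l] pdeg_left[of ?m r]
      sides_pos[of l] sides_pos[of r] by simp
  moreover have "image_mset (pdeg ?P) (mset_set {a<..<?m}) = inner l"
    unfolding Tri.IH(1)[of a, symmetric]
    by (rule image_mset_cong) (auto simp: pdeg_Tri pdeg_outside simp del: chords.simps)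
  moreover have "image_mset (pdeg ?P) (mset_set {?m<..<?b}) = inner r"
    unfolding Tri.IH(2)[of ?m, symmetric] add.assoc
    by (rule image_mset_cong) (auto simp: pdeg_Tri pdeg_outside simp del: chords.simps)
  ultimately show ?case by simp
qed

lemma image_pdeg: "image_mset (pdeg (chords a t)) (mset_set {a..a + sides t}) = degs t"
proof -
  have "{a..a + sides t} = insert a (insert (a + sides t) {a<..<a + sides t})"
    using sides_pos[of t] by auto
  moreover have "a \<noteq> a + sides t" using sides_pos[of t] by simp
  ultimately show ?thesis
    by (simp add: degs_def pdeg_left pdeg_right image_pdeg_inner)
qed

section \<open>Degrees and spread of maximal outerplanar graphs\<close>

lemma deg_eq_pdeg:
  assumes "\<And>e. e \<in> F \<Longrightarrow> card e = 2"
  shows "deg F v = pdeg (ordered_pairs F) v"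
proof -
  have "ordered_pairs {e \<in> F. v \<in> e} = {(i, j) \<in> ordered_pairs F. v = i \<or> v = j}"
    by (auto simp: ordered_pairs_def)
  then show ?thesis
    using card_ordered_pairs[of "{e \<in> F. v \<in> e}"] assms by (simp add: deg_def pdeg_def)
qed

lemma deg_image:
  assumes "inj_on f V" "E \<subseteq> Pow V" "v \<in> V"
  shows "deg ((`) f ` E) (f v) = deg E v"
proof -
  have "f v \<in> f ` e \<longleftrightarrow> v \<in> e" if "e \<in> E" for e
    using that assms by (intro inj_on_image_mem_iff) auto
  then have "{e \<in> (`) f ` E. f v \<in> e} = (`) f ` {e \<in> E. v \<in> e}" by auto
  moreover have "inj_on ((`) f) {e \<in> E. v \<in> e}"
    using assms(1,2) by (auto intro: inj_on_subset[OF inj_on_image_Pow])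
  ultimately show ?thesis by (simp add: deg_def card_image)
qed

lemma maximal_outerplanar_triang:
  assumes "maximal_outerplanar V E" "3 \<le> card V"
  shows "\<exists>t. Suc (sides t) = card V \<and> image_mset (deg E) (mset_set V) = degs t"
proof -
  let ?n = "card V"
  have sg: "simple_graph V E" using assms(1) by (simp add: maximal_outerplanar_def outerplanar_def)
  obtain f where f: "bij_betw f V {..<?n}" and nc: "noncrossing ((`) f ` E)"
    using assms(1) by (auto simp: maximal_outerplanar_def outerplanar_def)
  let ?F = "(`) f ` E"
  have edge: "e \<subseteq> {..<?n} \<and> card e = 2" if "e \<in> ?F" for e using image_edge[OF sg f that] .
  \<comment> \<open>The numbering \<open>g\<close> may differ from \<open>f\<close>; it serves to
    count the edges, and the count \<open>2 * ?n - 3\<close> makes the chords under \<open>f\<close>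
    a full noncrossing set.\<close>
  obtain g where g: "bij_betw g V {..<?n}" "polygon_triangulation ?n ((`) g ` E)"
    using maximal_outerplanar_iff_triangulation[OF refl assms(2)] assms(1) by blast
  then obtain D where D: "D \<subseteq> polygon_diagonals ?n" "card D = ?n - 3"
      "(`) g ` E = polygon_sides ?n \<union> D"
    unfolding polygon_triangulation_def by (elim conjE exE)
  have "finite E"
    by (rule finite_subset[of _ "Pow V"]) (use sg in \<open>auto simp: simple_graph_def\<close>)
  then have "finite (polygon_sides ?n \<union> D)" by (simp flip: D(3))
  then have "card (polygon_sides ?n \<union> D) = card (polygon_sides ?n) + card D"
    using D(1) by (intro card_Un_disjoint) (auto simp: polygon_diagonals_def)
  then have cardF: "card ?F = 2 * ?n - 3"
    using card_image_edges[OF sg f] card_image_edges[OF sg g(1)] card_polygon_sides[OF assms(2)]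
      D(2,3) assms(2) by simp
  have "\<exists>t. sides t = ?n - 1 - 0 \<and> ordered_pairs ?F = chords 0 t"
  proof (rule full_noncrossing_chords)
    show "0 < ?n - 1" using assms(2) by simp
    show "ordered_pairs ?F \<subseteq> {(i, j). 0 \<le> i \<and> i < j \<and> j \<le> ?n - 1}"
      using ordered_pairs_subset edge by blast
    show "\<not> (i < k \<and> k < j \<and> j < l)"
      if "(i, j) \<in> ordered_pairs ?F" "(k, l) \<in> ordered_pairs ?F" for i j k l
      using ordered_pairs_noncrossing[OF nc that] .
    show "card (ordered_pairs ?F) = 2 * (?n - 1 - 0) - 1"
      using card_ordered_pairs[of ?F] edge cardF assms(2) by simp
  qed
  then obtain t where t: "sides t = ?n - 1 - 0" and pairs: "ordered_pairs ?F = chords 0 t"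
    by (elim exE conjE)
  from t have t: "Suc (sides t) = ?n" using assms(2) by simp
  have E: "E \<subseteq> Pow V" using sg by (auto simp: simple_graph_def)
  have inj: "inj_on f V" and im: "f ` V = {0..0 + sides t}"
    using f t by (auto simp: bij_betw_def)
  have "finite V" using sg by (simp add: simple_graph_def)
  then have "image_mset (deg E) (mset_set V) =
      image_mset (\<lambda>v. pdeg (chords 0 t) (f v)) (mset_set V)"
    using deg_image[OF inj E] deg_eq_pdeg[of ?F] edge pairs by (intro image_mset_cong) auto
  also have "\<dots> = image_mset (pdeg (chords 0 t)) (mset_set (f ` V))"
    by (simp flip: image_mset_mset_set[OF inj] add: multiset.map_comp comp_def)
  also have "\<dots> = degs t" unfolding im by (rule image_pdeg)
  finally show ?thesis using t by blast
qed

lemma triang_maximal_outerplanar: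
  fixes t :: triang
  defines "V \<equiv> {..sides t}" and "E \<equiv> (\<lambda>(i, j). {i, j}) ` chords 0 t"
  shows "maximal_outerplanar V E" and "image_mset (deg E) (mset_set V) = degs t"
proof -
  have ordered: "i < j \<and> j \<le> sides t" if "(i, j) \<in> chords 0 t" for i j
    using chords_bounds[OF that] by simp
  then have edge: "e \<subseteq> V \<and> card e = 2" if "e \<in> E" for e
    using that by (fastforce simp: V_def E_def)
  have pairs: "ordered_pairs E = chords 0 t"
    using ordered by (fastforce simp: ordered_pairs_def E_def doubleton_eq_iff)
  have sg: "simple_graph V E" using edge by (auto simp: simple_graph_def V_def)
  have cardV: "card V = Suc (sides t)" and V: "V = {..<card V}" by (auto simp: V_def)
  have "noncrossing E"
    unfolding noncrossing_def
  proof (intro ballI)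
    fix e e' assume "e \<in> E" "e' \<in> E"
    then obtain i j k l where "(i, j) \<in> chords 0 t" "e = {i, j}" "(k, l) \<in> chords 0 t" "e' = {k, l}"
      by (auto simp: E_def)
    then show "\<not> chords_cross e e'"
      using chords_noncrossing[of i j 0 t k l] ordered chords_cross_ordered by simp
  qed
  then have op: "outerplanar V E"
    unfolding outerplanar_def using sg V by (intro conjI exI[of _ id]) auto
  have cardE: "Suc (card E) = 2 * sides t"
    using card_ordered_pairs[of E] edge pairs card_chords[of 0 t] by simp
  have finE: "finite E" by (simp add: E_def)
  \<comment> \<open>\<open>E\<close> already has the largest size of a noncrossing set of chords, so
    one more edge is impossible under any numbering \<open>g\<close>.\<close>
  have "\<not> outerplanar V (insert {u, v} E)" if "{u, v} \<notin> E" for u v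
  proof
    assume "outerplanar V (insert {u, v} E)"
    then obtain g where sg': "simple_graph V (insert {u, v} E)"
      and g: "bij_betw g V {..<card V}" "noncrossing ((`) g ` insert {u, v} E)"
      unfolding outerplanar_def by blast
    have "card ((`) g ` insert {u, v} E) \<le> 2 * card V - 3"
    proof (rule card_noncrossing_le)
      show "2 \<le> card V" using cardV sides_pos[of t] by simp
      show "e \<subseteq> {..<card V} \<and> card e = 2" if "e \<in> (`) g ` insert {u, v} E" for e
        using image_edge[OF sg' g(1) that] .
    qed (rule g(2))
    then show False
      using card_image_edges[OF sg' g(1)] that finE cardE cardV by simp
  qed
  then show "maximal_outerplanar V E" using op by (auto simp: maximal_outerplanar_def)
  have "image_mset (deg E) (mset_set V) = image_mset (pdeg (chords 0 t)) (mset_set {0..0 + sides t})"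
    using deg_eq_pdeg[of E] edge pairs
    by (intro arg_cong2[where f = image_mset] ext) (auto simp: V_def atMost_atLeast0)
  then show "image_mset (deg E) (mset_set V) = degs t" by (simp only: image_pdeg)
qed

section \<open>Spread number and windows of degrees\<close>

lemma window_deg:
  assumes "finite V"
  shows "window j (image_mset (deg E) (mset_set V)) = card {v \<in> V. j \<le> deg E v \<and> deg E v \<le> j + 2}"
  using assms by (simp add: window_def filter_mset_image_mset)

lemma window_le_spread_number:
  assumes "finite V"
  shows "window j (image_mset (deg E) (mset_set V)) \<le> spread_number V E 2"
proof -
  let ?S = "{card B | B. B \<subseteq> V \<and> B \<noteq> {} \<and> spread E B \<le> 2}"
  let ?B = "{v \<in> V. j \<le> deg E v \<and> deg E v \<le> j + 2}"
  have "?S \<subseteq> {..card V}" using assms by (auto intro: card_mono)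
  then have fin: "finite ?S" by (rule finite_subset) auto
  show ?thesis
  proof (cases "?B = {}")
    case False
    have "finite ?B" using assms by simp
    then have "Max (deg E ` ?B) \<le> j + 2" "j \<le> Min (deg E ` ?B)"
      using False by (subst Max_le_iff Min_ge_iff; auto)+
    then have "spread E ?B \<le> 2" by (simp add: spread_def)
    then have "card ?B \<in> ?S" using False by blast
    then show ?thesis
      unfolding window_deg[OF assms] spread_number_def using fin by (intro Max_ge)
  qed (simp add: window_deg[OF assms] del: Collect_empty_eq)
qed

text \<open>A set of spread at most 2 lies in the window that starts at its least degree.\<close>

lemma spread_number_le:
  assumes "finite V" "V \<noteq> {}" "\<And>j. window j (image_mset (deg E) (mset_set V)) \<le> s"
  shows "spread_number V E 2 \<le> s"
proof -
  let ?S = "{card B | B. B \<subseteq> V \<and> B \<noteq> {} \<and> spread E B \<le> 2}"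
  have "?S \<subseteq> {..card V}" using assms(1) by (auto intro: card_mono)
  then have fin: "finite ?S" by (rule finite_subset) auto
  obtain v where "v \<in> V" using assms(2) by auto
  then have "card {v} \<in> ?S" by (intro CollectI exI[of _ "{v}"]) (auto simp: spread_def)
  moreover have "card B \<le> s" if B: "B \<subseteq> V" "B \<noteq> {}" "spread E B \<le> 2" for B
  proof -
    let ?j = "Min (deg E ` B)"
    have "finite B" using B(1) assms(1) by (rule finite_subset)
    then have "?j \<le> deg E v \<and> deg E v \<le> Max (deg E ` B)" if "v \<in> B" for v
      using that by simp
    then have "?j \<le> deg E v \<and> deg E v \<le> ?j + 2" if "v \<in> B" for v
      using that B(3) unfolding spread_def by fastforce
    then have "B \<subseteq> {v \<in> V. ?j \<le> deg E v \<and> deg E v \<le> ?j + 2}" using B(1) by blast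
    then have "card B \<le> card {v \<in> V. ?j \<le> deg E v \<and> deg E v \<le> ?j + 2}"
      using assms(1) by (intro card_mono) auto
    then show ?thesis using assms(3)[of ?j] window_deg[OF assms(1)] by simp
  qed
  ultimately show ?thesis unfolding spread_number_def using fin by (subst Max_le_iff) auto
qed

lemma MOP_lower_bound:
  assumes "5 \<le> n"
  shows "4 * n + 10 \<le> 9 * MOP n 2"
proof -
  obtain V :: "nat set" and E where VE: "maximal_outerplanar V E" "card V = n"
      "MOP n 2 = spread_number V E 2"
    using MOP_attained(1)[of n 2] assms by auto
  obtain t where t: "Suc (sides t) = n" "image_mset (deg E) (mset_set V) = degs t"
    using maximal_outerplanar_triang[OF VE(1)] VE(2) assms by auto
  have "finite V" using VE(2) assms by (intro card_ge_0_finite) simp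
  then have "window j (degs t) \<le> MOP n 2" for j
    using window_le_spread_number[of V j E] VE(3) t(2) by simp
  then show ?thesis using degs_window_lower_bound[of t] t(1) assms by simp
qed

lemma MOP_le:
  assumes "\<And>j. window j (degs t) \<le> s"
  shows "MOP (Suc (sides t)) 2 \<le> s"
proof -
  let ?V = "{..sides t}" and ?E = "(\<lambda>(i, j). {i, j}) ` chords 0 t"
  have "MOP (Suc (sides t)) 2 \<le> spread_number ?V ?E 2"
    using MOP_attained(2)[OF _ triang_maximal_outerplanar(1)[of t]] by simp
  also have "\<dots> \<le> s"
    by (rule spread_number_le) (use assms triang_maximal_outerplanar(2)[of t] in auto)
  finally show ?thesis .
qed

section \<open>The extremal triangulations\<close>

abbreviation ear :: triang where "ear \<equiv> Tri Side Side"

text \<open>One period consists of ten triangles of the strip and eight ears. The pattern was found by a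
  search through the strips whose degrees make the lower bound tight.\<close>

definition extend :: "triang \<Rightarrow> triang" where
  "extend t = Tri ear (Tri ear (Tri ear (Tri ear (Tri (Tri Side
     (Tri (Tri (Tri (Tri t ear) ear) ear) ear)) Side))))"

lemma sides_extend: "sides (extend t) = sides t + 18"
  by (simp add: extend_def)

lemma degs_extend_Side:
  "ldeg (extend Side) = 3" "rdeg (extend Side) = 6"
  "degs (extend Side) =
     replicate_mset 8 2 + replicate_mset 2 3 + replicate_mset 8 5 + replicate_mset 2 6"
  by (simp_all add: extend_def degs_def numeral_eq_Suc)

text \<open>The ends of the old base, of degrees 3 and 6, become inner vertices of degree 8, and the
  new base again has ends of degrees 3 and 6, so the step can be repeated.\<close>

lemma degs_extend:
  assumes "ldeg t = 3" "rdeg t = 6"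
  shows "ldeg (extend t) = 3" "rdeg (extend t) = 6"
    "degs (extend t) =
      replicate_mset 8 2 + replicate_mset 8 5 + replicate_mset 2 8 + degs t"
  using assms by (simp_all add: extend_def degs_def numeral_eq_Suc)

lemma sides_extend_iterate: "sides ((extend ^^ k) Side) = 18 * k + 1"
  by (induction k) (auto simp: sides_extend)

lemma degs_extend_iterate:
  "ldeg ((extend ^^ Suc k) Side) = 3 \<and> rdeg ((extend ^^ Suc k) Side) = 6 \<and>
   degs ((extend ^^ Suc k) Side) =
     replicate_mset (8 * Suc k) 2 + replicate_mset 2 3 + replicate_mset (8 * Suc k) 5 +
     replicate_mset 2 6 + replicate_mset (2 * k) 8"
proof (induction k)
  case 0
  then show ?case using degs_extend_Side by simp
next
  case (Suc k)
  have rep: "replicate_mset (m + n) x = replicate_mset m x + replicate_mset n x"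
    for m n and x :: nat
    by (induction m) auto
  have "8 * Suc (Suc k) = 8 + 8 * Suc k" "2 * Suc k = 2 + 2 * k" by simp_all
  then show ?case
    using Suc degs_extend[of "(extend ^^ Suc k) Side"]
    by (simp only: funpow.simps(2) comp_def rep) (simp add: ac_simps)
qed

lemma window_union [simp]: "window j (M + N) = window j M + window j N"
  by (simp add: window_def)

lemma window_replicate [simp]:
  "window j (replicate_mset n d) = (if j \<le> d \<and> d \<le> j + 2 then n else 0)"
  by (induction n) (auto simp: window_def)

text \<open>No window contains two of the degrees 2, 5 and 8, nor both 3 and 6.\<close>

lemma window_extend_iterate:
  assumes "1 \<le> k"
  shows "window j (degs ((extend ^^ k) Side)) \<le> 8 * k + 2"
proof -
  obtain m where "k = Suc m" using assms by (cases k) auto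
  then show ?thesis using degs_extend_iterate[of m] by auto
qed

text \<open>Gluing an ear to the base adds one vertex and changes the degrees of two others.\<close>

lemma window_add_ears:
  "window j (degs (((\<lambda>t. Tri t Side) ^^ r) t)) \<le> window j (degs t) + 3 * r"
proof (induction r)
  case (Suc r)
  have "window j (degs (Tri s Side)) \<le> window j (degs s) + 3" for s
    by (auto simp: window_def degs_def)
  from this[of "((\<lambda>t. Tri t Side) ^^ r) t"] show ?case using Suc by simp
qed simp

lemma sides_add_ears: "sides (((\<lambda>t. Tri t Side) ^^ r) t) = sides t + r"
  by (induction r) auto

lemma MOP_upper_bound:
  assumes "1 \<le> k"
  shows "MOP (18 * k + 2 + r) 2 \<le> 8 * k + 2 + 3 * r"
proof -
  let ?t = "((\<lambda>t. Tri t Side) ^^ r) ((extend ^^ k) Side)"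
  have "window j (degs ?t) \<le> 8 * k + 2 + 3 * r" for j
    using window_add_ears[of j r "(extend ^^ k) Side"] window_extend_iterate[OF assms, of j] by simp
  moreover have "Suc (sides ?t) = 18 * k + 2 + r"
    by (simp add: sides_add_ears sides_extend_iterate)
  ultimately show ?thesis using MOP_le[of ?t] by simp
qed

theorem theorem21:
  "(\<forall>n\<ge>5. \<lceil>(4 * real n + 10) / 9\<rceil> \<le> int (MOP n 2)) \<and>
   (\<forall>n\<ge>5. n mod 18 = 2 \<longrightarrow> int (MOP n 2) = \<lceil>(4 * real n + 10) / 9\<rceil>) \<and>
   (\<forall>n\<ge>20. int (MOP n 2) \<le> \<lceil>(4 * real n + 10) / 9\<rceil> + 43) \<and>
   (\<lambda>n. real (MOP n 2) - 4 * real n / 9) \<in> O(\<lambda>_. 1)"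
proof (intro conjI allI impI)
  have lower: "4 * real n + 10 \<le> 9 * real (MOP n 2)" if "5 \<le> n" for n
    using MOP_lower_bound[OF that] by linarith
  then show lower_ceiling: "\<lceil>(4 * real n + 10) / 9\<rceil> \<le> int (MOP n 2)" if "5 \<le> n" for n
    using lower[OF that] by (simp add: ceiling_le_iff field_simps)
  have upper: "\<exists>k r. n = 18 * k + 2 + r \<and> r = (n - 2) mod 18 \<and> r < 18 \<and>
      MOP n 2 \<le> 8 * k + 2 + 3 * r"
    if "20 \<le> n" for n
  proof -
    let ?k = "(n - 2) div 18" and ?r = "(n - 2) mod 18"
    have "n = 18 * ?k + 2 + ?r" "1 \<le> ?k" using that by presburger+
    then show ?thesis using MOP_upper_bound[of ?k ?r] by (metis mod_less_divisor zero_less_numeral)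
  qed
  show "int (MOP n 2) = \<lceil>(4 * real n + 10) / 9\<rceil>" if "5 \<le> n" "n mod 18 = 2" for n
  proof -
    \<comment> \<open>The residue leaves \<open>n = 2\<close> or \<open>n \<ge> 20\<close>, and
      \<open>5 \<le> n\<close> excludes the former.\<close>
    have "20 \<le> n" "(n - 2) mod 18 = 0" using that by presburger+
    then obtain k where k: "n = 18 * k + 2" "MOP n 2 \<le> 8 * k + 2"
      using upper[of n] by auto
    then have "(4 * real n + 10) / 9 = real (8 * k + 2)" by simp
    then have "\<lceil>(4 * real n + 10) / 9\<rceil> = int (8 * k + 2)" by (simp only: ceiling_of_nat)
    then show ?thesis using lower_ceiling[OF that(1)] k(2) by linarith
  qed
  show upper_ceiling: "int (MOP n 2) \<le> \<lceil>(4 * real n + 10) / 9\<rceil> + 43" if n: "20 \<le> n" for n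
  proof -
    obtain k r where k: "n = 18 * k + 2 + r" "r < 18" "MOP n 2 \<le> 8 * k + 2 + 3 * r"
      using upper[OF n] by blast
    \<comment> \<open>Here \<open>(4 * n + 10) / 9 = 8 * k + 2 + 4 * r / 9\<close>, so the excess is
      at most \<open>23 * r / 9 \<le> 391 / 9 < 44\<close>.\<close>
    then have "real (MOP n 2) - 44 < (4 * real n + 10) / 9" by simp
    then show ?thesis by linarith
  qed
  show "(\<lambda>n. real (MOP n 2) - 4 * real n / 9) \<in> O(\<lambda>_. 1)"
  \<comment> \<open>The difference lies between \<open>10 / 9\<close> and
    \<open>44 + 10 / 9 < 46\<close>.\<close>
  proof (rule bigoI[of _ 46])
    have "norm (real (MOP n 2) - 4 * real n / 9) \<le> 46 * norm (1 :: real)" if "20 \<le> n" for n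
    proof -
      have "real (MOP n 2) - 44 < (4 * real n + 10) / 9"
        using upper_ceiling[OF that] by linarith
      moreover have "4 * real n + 10 \<le> 9 * real (MOP n 2)" using lower that by simp
      ultimately show ?thesis by (simp add: abs_le_iff field_simps)
    qed
    then show "\<forall>\<^sub>F n in sequentially. norm (real (MOP n 2) - 4 * real n / 9) \<le> 46 * norm (1 :: real)"
      by (rule eventually_sequentiallyI)
  qed
qed

end
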